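(* Let $q=W+X\boldsymbol{i}+Y\boldsymbol{j}+Z\boldsymbol{k}$ be a biquaternion, with $W,X,Y,Z\in\mathbb{C}$. If $W=0$ and $X^2+Y^2+Z^2=0$, then $q$ is nilpotent, i.e. $q^2=0$.
   Context: Biquaternions are quaternions with complex coefficients, $q=W+X\boldsymbol{i}+Y\boldsymbol{j}+Z\boldsymbol{k}$ with $W,X,Y,Z\in\mathbb{C}$, where $\boldsymbol{i},\boldsymbol{j},\boldsymbol{k}$ are the usual quaternion units and complex scalars commute with $\boldsymbol{i},\boldsymbol{j},\boldsymbol{k}$. A biquaternion $q$ is called nilpotent if $q^2=0$. *)

theory Defs
  imports Complex_Main
begin

datatype biquaternion =
  Biquaternion (Scal: complex) (Im1: complex) (Im2: complex) (Im3: complex)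

lemma biquaternion_eq_iff:
  "p = q \<longleftrightarrow> Scal p = Scal q \<and> Im1 p = Im1 q \<and> Im2 p = Im2 q \<and> Im3 p = Im3 q"
  by (cases p; cases q) simp

instantiation biquaternion :: ring_1
begin

definition zero_biquaternion :: biquaternion
  where "0 = Biquaternion 0 0 0 0"

definition one_biquaternion :: biquaternion
  where "1 = Biquaternion 1 0 0 0"

definition plus_biquaternion :: "biquaternion \<Rightarrow> biquaternion \<Rightarrow> biquaternion"
  where "p + q = Biquaternion (Scal p + Scal q) (Im1 p + Im1 q) (Im2 p + Im2 q) (Im3 p + Im3 q)"

definition uminus_biquaternion :: "biquaternion \<Rightarrow> biquaternion"
  where "- p = Biquaternion (- Scal p) (- Im1 p) (- Im2 p) (- Im3 p)"

definition minus_biquaternion :: "biquaternion \<Rightarrow> biquaternion \<Rightarrow> biquaternion"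
  where "p - q = Biquaternion (Scal p - Scal q) (Im1 p - Im1 q) (Im2 p - Im2 q) (Im3 p - Im3 q)"

definition times_biquaternion :: "biquaternion \<Rightarrow> biquaternion \<Rightarrow> biquaternion"
  where "p * q = Biquaternion
    (Scal p * Scal q - Im1 p * Im1 q - Im2 p * Im2 q - Im3 p * Im3 q)
    (Scal p * Im1 q + Im1 p * Scal q + Im2 p * Im3 q - Im3 p * Im2 q)
    (Scal p * Im2 q - Im1 p * Im3 q + Im2 p * Scal q + Im3 p * Im1 q)
    (Scal p * Im3 q + Im1 p * Im2 q - Im2 p * Im1 q + Im3 p * Scal q)"

instance
  by standard
    (simp_all add: biquaternion_eq_iff zero_biquaternion_def one_biquaternion_def
      plus_biquaternion_def uminus_biquaternion_def minus_biquaternion_def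
      times_biquaternion_def algebra_simps)

end

text \<open>The quaternion unit \<open>\<i>\<^sub>q\<close> below is different from the image of the imaginary unit
  of the complex scalars, which is central.\<close>

definition biquaternion_of_complex :: "complex \<Rightarrow> biquaternion"
  where "biquaternion_of_complex c = Biquaternion c 0 0 0"

definition quat_i :: biquaternion ("\<i>\<^sub>q")
  where "\<i>\<^sub>q = Biquaternion 0 1 0 0"

definition quat_j :: biquaternion ("\<j>\<^sub>q")
  where "\<j>\<^sub>q = Biquaternion 0 0 1 0"

definition quat_k :: biquaternion ("\<k>\<^sub>q")
  where "\<k>\<^sub>q = Biquaternion 0 0 0 1"

lemmas biquaternion_defs =
  zero_biquaternion_def one_biquaternion_def plus_biquaternion_def uminus_biquaternion_def
  minus_biquaternion_def times_biquaternion_def biquaternion_of_complex_def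
  quat_i_def quat_j_def quat_k_def

lemma quat_unit_mult:
  "\<i>\<^sub>q * \<i>\<^sub>q = - 1" "\<j>\<^sub>q * \<j>\<^sub>q = - 1" "\<k>\<^sub>q * \<k>\<^sub>q = - 1"
  "\<i>\<^sub>q * \<j>\<^sub>q = \<k>\<^sub>q" "\<j>\<^sub>q * \<k>\<^sub>q = \<i>\<^sub>q" "\<k>\<^sub>q * \<i>\<^sub>q = \<j>\<^sub>q"
  "\<j>\<^sub>q * \<i>\<^sub>q = - \<k>\<^sub>q" "\<k>\<^sub>q * \<j>\<^sub>q = - \<i>\<^sub>q" "\<i>\<^sub>q * \<k>\<^sub>q = - \<j>\<^sub>q"
  by (simp_all add: biquaternion_defs)

lemma biquaternion_of_complex_hom:
  "biquaternion_of_complex 1 = 1"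
  "biquaternion_of_complex (a + b) = biquaternion_of_complex a + biquaternion_of_complex b"
  "biquaternion_of_complex (a * b) = biquaternion_of_complex a * biquaternion_of_complex b"
  by (simp_all add: biquaternion_defs)

lemma biquaternion_of_complex_central:
  "biquaternion_of_complex c * q = q * biquaternion_of_complex c"
  by (simp add: biquaternion_defs mult.commute)

lemma biquaternion_expansion:
  "Biquaternion W X Y Z = biquaternion_of_complex W + biquaternion_of_complex X * \<i>\<^sub>q
     + biquaternion_of_complex Y * \<j>\<^sub>q + biquaternion_of_complex Z * \<k>\<^sub>q"
  by (simp add: biquaternion_defs)

definition nilpotent_biquaternion :: "biquaternion \<Rightarrow> bool"
  where "nilpotent_biquaternion q \<longleftrightarrow> q\<^sup>2 = 0"

end

theory Submission
  imports Defs
begin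

text \<open>Distinct quaternion units anticommute and complex scalars are central, so squaring a
  biquaternion with zero scalar part cancels the cross terms in pairs. What remains is the scalar
  -(X^2 + Y^2 + Z^2).\<close>

theorem theorem5:
  fixes q :: biquaternion and W X Y Z :: complex
  assumes "q = biquaternion_of_complex W + biquaternion_of_complex X * \<i>\<^sub>q
               + biquaternion_of_complex Y * \<j>\<^sub>q + biquaternion_of_complex Z * \<k>\<^sub>q"
    and "W = 0"
    and "X\<^sup>2 + Y\<^sup>2 + Z\<^sup>2 = 0"
  shows "nilpotent_biquaternion q"
proof -
  have q: "q = Biquaternion 0 X Y Z"
    using assms(1,2) by (simp only: biquaternion_expansion)
  \<comment> \<open>The left side is the scalar component of \<open>q * q\<close> in the shape
    \<open>simp\<close> gives it.\<close>
  have "- (X * X) - Y * Y - Z * Z = - (X\<^sup>2 + Y\<^sup>2 + Z\<^sup>2)"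
    by (simp add: power2_eq_square)
  also have "\<dots> = 0"
    using assms(3) by simp
  \<comment> \<open>\<open>mult.commute\<close> cancels the cross terms, such as
    \<open>Y * Z - Z * Y\<close>, in the other components.\<close>
  finally show ?thesis
    by (simp add: nilpotent_biquaternion_def q power2_eq_square times_biquaternion_def
        zero_biquaternion_def mult.commute)
qed

end
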